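(* Let $G$ be a finite claw-free graph with maximum degree at most $\Delta$, and let $n\geq 1$ be an integer. Then every collection of $\left\lfloor\left(\frac{\Delta}{2}+1\right)(n-1)\right\rfloor+1$ (not necessarily distinct) independent sets of size $n$ in $G$ has a rainbow independent set of size $n$; that is, $f_G(n)\leq \left\lfloor\left(\frac{\Delta}{2}+1\right)(n-1)\right\rfloor+1$.
   Context: Graphs are finite, simple and undirected. A graph is claw-free if it has no induced subgraph isomorphic to $K_{1,3}$. Given a family $A_1,\dots,A_m$ of (not necessarily distinct) subsets of $V$, a rainbow set of size $n$ is a set of $n$ distinct elements $\{a_{i_1},\dots,a_{i_n}\}$ with $1\leq i_1<\dots<i_n\leq m$ and $a_{i_j}\in A_{i_j}$; a rainbow independent set is a rainbow set that is independent in $G$. $f_G(n)$ denotes the minimum $t$ such that every collection of $t$ independent sets of size $n$ in $G$ has a rainbow independent set of size $n$. *)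

theory Defs
  imports Complex_Main "Graph_Theory.Graph_Theory"
begin

text \<open>A finite simple undirected graph is a \<^locale>\<open>pair_graph\<close>: finite vertex set and a symmetric,
  irreflexive arc relation. Each edge is stored as the two arcs \<open>(u, v)\<close> and \<open>(v, u)\<close>.\<close>

definition claw_free :: "'a pair_pre_digraph \<Rightarrow> bool" where
  "claw_free G \<longleftrightarrow> \<not> (\<exists>H. induced_subgraph H (with_proj G) \<and> K\<^bsub>1,3\<^esub> H)"

text \<open>In a symmetric digraph, the arcs leaving \<open>v\<close> correspond to the edges at \<open>v\<close>.\<close>

definition vertex_degree :: "'a pair_pre_digraph \<Rightarrow> 'a \<Rightarrow> nat" where
  "vertex_degree G v = out_degree (with_proj G) v"

text \<open>The \<open>0\<close> only matters for the graph without vertices, whose maximum degree is taken to be \<open>0\<close>.\<close>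

definition max_degree :: "'a pair_pre_digraph \<Rightarrow> nat" where
  "max_degree G = Max (insert 0 (vertex_degree G ` pverts G))"

definition independent_set :: "'a pair_pre_digraph \<Rightarrow> 'a set \<Rightarrow> bool" where
  "independent_set G S \<longleftrightarrow> S \<subseteq> pverts G \<and> (\<forall>u\<in>S. \<forall>v\<in>S. (u, v) \<notin> parcs G)"

text \<open>A family \<open>A\<^sub>1, \<dots>, A\<^sub>m\<close> is a function \<open>A\<close> of which only the values on \<open>{1..m}\<close> are used.
  \<open>rainbow_set A m n R\<close>: \<open>R\<close> is a rainbow set of size \<open>n\<close> of this family.\<close>

definition rainbow_set :: "(nat \<Rightarrow> 'a set) \<Rightarrow> nat \<Rightarrow> nat \<Rightarrow> 'a set \<Rightarrow> bool" where
  "rainbow_set A m n R \<longleftrightarrow>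
     (\<exists>i a. strict_mono_on {1..n} i \<and> i ` {1..n} \<subseteq> {1..m} \<and>
        (\<forall>j\<in>{1..n}. a j \<in> A (i j)) \<and> inj_on a {1..n} \<and> R = a ` {1..n})"

definition forces_rainbow_independent :: "'a pair_pre_digraph \<Rightarrow> nat \<Rightarrow> nat \<Rightarrow> bool" where
  "forces_rainbow_independent G n t \<longleftrightarrow>
     (\<forall>A. (\<forall>k\<in>{1..t}. independent_set G (A k) \<and> card (A k) = n) \<longrightarrow>
        (\<exists>R. rainbow_set A t n R \<and> independent_set G R))"

text \<open>\<open>rainbow_number G n\<close> is \<open>f\<^sub>G(n)\<close>. As a \<open>LEAST\<close>, it is meaningful only together with the
  existence of some \<open>t\<close> such that \<^term>\<open>forces_rainbow_independent G n t\<close>.\<close>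

definition rainbow_number :: "'a pair_pre_digraph \<Rightarrow> nat \<Rightarrow> nat" where
  "rainbow_number G n = (LEAST t. forces_rainbow_independent G n t)"

end

theory Submission
  imports Defs
begin

text \<open>A rainbow independent set \<open>R\<close> of size \<open>r < n\<close> can be enlarged as long as the set \<open>J\<close> of unused
  colours satisfies \<open>2 |J| > \<Delta> r\<close>. The edges between \<open>R\<close> and the other vertices, of which there are at
  most \<open>\<Delta> r\<close>, pay for the unused colours. Every colour class \<open>A j\<close> together with \<open>R\<close> contains an
  independent set of size \<open>r + 1\<close>. This property is kept for a growing set \<open>S \<supseteq> R\<close> and a shrinking set
  \<open>T\<close> of available vertices. A vertex of \<open>T\<close> with at least two neighbours in \<open>R\<close> is dropped if
  no colour depends on it; otherwise it is moved to \<open>S\<close> at the expense of one such colour, and it pays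
  with its two edges. When only vertices with at most one neighbour in \<open>R\<close> are left in \<open>T\<close>, an
  augmentation of \<open>R\<close> needs at most two vertices of \<open>T\<close>, the ends of an alternating path. So either
  two colours supply these two ends, or both ends occur in a single colour and pay for
  it with one edge each.\<close>

section \<open>Independent sets and partial rainbow sets\<close>

lemma independent_setD:
  "independent_set G Z \<Longrightarrow> u \<in> Z \<Longrightarrow> v \<in> Z \<Longrightarrow> (u, v) \<notin> parcs G"
  by (auto simp: independent_set_def)

lemma independent_set_subset:
  "independent_set G Z \<Longrightarrow> Y \<subseteq> Z \<Longrightarrow> independent_set G Y"
  by (auto simp: independent_set_def)

definition neighbours_in :: "'a pair_pre_digraph \<Rightarrow> 'a set \<Rightarrow> 'a \<Rightarrow> 'a set" where
  "neighbours_in G I x = {v \<in> I. (x, v) \<in> parcs G}"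

definition has_independent :: "'a pair_pre_digraph \<Rightarrow> 'a set \<Rightarrow> nat \<Rightarrow> bool" where
  "has_independent G S k \<longleftrightarrow> (\<exists>Z\<subseteq>S. independent_set G Z \<and> card Z = k)"

lemma has_independent_mono: "has_independent G S k \<Longrightarrow> S \<subseteq> S' \<Longrightarrow> has_independent G S' k"
  by (auto simp: has_independent_def)

text \<open>Colours are the indices of the family. An injective colouring takes the place of the two
  enumerations in \<open>rainbow_set\<close>, so that choices with disjoint colour sets can simply
  be united.\<close>

definition rainbow_from :: "(nat \<Rightarrow> 'a set) \<Rightarrow> nat set \<Rightarrow> 'a set \<Rightarrow> bool" where
  "rainbow_from A J W \<longleftrightarrow> (\<exists>c. inj_on c W \<and> c ` W \<subseteq> J \<and> (\<forall>w\<in>W. w \<in> A (c w)))"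

lemma rainbow_from_empty: "rainbow_from A J {}"
  by (simp add: rainbow_from_def)

lemma rainbow_from_mono: "rainbow_from A J W \<Longrightarrow> J \<subseteq> J' \<Longrightarrow> rainbow_from A J' W"
  unfolding rainbow_from_def by blast

lemma rainbow_from_subset: "rainbow_from A J W \<Longrightarrow> W' \<subseteq> W \<Longrightarrow> rainbow_from A J W'"
  unfolding rainbow_from_def by (meson image_mono inj_on_subset order_trans subsetD)

lemma rainbow_from_Un:
  assumes "rainbow_from A J V" and "rainbow_from A J' W" and "J \<inter> J' = {}"
  shows "rainbow_from A (J \<union> J') (V \<union> W)"
proof -
  obtain c where c: "inj_on c V" "c ` V \<subseteq> J" "\<forall>w\<in>V. w \<in> A (c w)"
    using assms(1) by (auto simp: rainbow_from_def)
  obtain d where d: "inj_on d W" "d ` W \<subseteq> J'" "\<forall>w\<in>W. w \<in> A (d w)"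
    using assms(2) by (auto simp: rainbow_from_def)
  let ?f = "\<lambda>x. if x \<in> V then c x else d x"
  have disj: "c x \<noteq> d y" if "x \<in> V" "y \<in> W" for x y
    using that c(2) d(2) assms(3) by blast
  have "inj_on ?f (V \<union> W)"
  proof (rule inj_onI)
    fix x y assume "x \<in> V \<union> W" "y \<in> V \<union> W" "?f x = ?f y"
    then show "x = y"
      using inj_onD[OF c(1), of x y] inj_onD[OF d(1), of x y] disj[of x y] disj[of y x]
      by (cases "x \<in> V"; cases "y \<in> V") auto
  qed
  moreover have "?f ` (V \<union> W) \<subseteq> J \<union> J'" "\<forall>w\<in>V \<union> W. w \<in> A (?f w)"
    using c d by auto
  ultimately show ?thesis
    unfolding rainbow_from_def by blast
qed

lemma rainbow_from_singleton: "j \<in> J \<Longrightarrow> x \<in> A j \<Longrightarrow> rainbow_from A J {x}"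
  unfolding rainbow_from_def by (intro exI[of _ "\<lambda>_. j"]) auto

lemma rainbow_from_pair:
  assumes "i \<in> J" "j \<in> J" "i \<noteq> j" "x \<in> A i" "y \<in> A j"
  shows "rainbow_from A J {x, y}"
proof -
  have "rainbow_from A ({i} \<union> {j}) ({x} \<union> {y})"
    using assms by (intro rainbow_from_Un rainbow_from_singleton) auto
  then show ?thesis
    unfolding insert_is_Un[of x "{y}"] by (rule rainbow_from_mono) (use assms in auto)
qed

text \<open>Sorting the colours in use gives the increasing indices \<open>i\<close>; inverting the
  colouring along \<open>i\<close> gives the elements \<open>a\<close>.\<close>

lemma rainbow_set_of_rainbow_from:
  assumes "rainbow_from A {1..m} R" and "finite R" and "card R = n"
  shows "rainbow_set A m n R"
proof -
  obtain c where c: "inj_on c R" "c ` R \<subseteq> {1..m}" "\<forall>w\<in>R. w \<in> A (c w)"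
    using assms(1) by (auto simp: rainbow_from_def)
  define l where "l = sorted_list_of_set (c ` R)"
  have l: "sorted_wrt (<) l" "set l = c ` R" "length l = n" "distinct l"
    using assms(2,3) c(1) by (auto simp: l_def card_image)
  define i where "i j = l ! (j - 1)" for j
  \<comment> \<open>\<open>rainbow_set\<close> counts from 1, list positions from 0.\<close>
  have "{0..<n} = (\<lambda>j. j - 1) ` {1..n}"
    by (auto simp: image_iff intro!: bexI[of _ "Suc _"])
  then have i_img: "i ` {1..n} = c ` R"
    using nth_image[of n l] l(2,3) by (simp add: i_def image_image)
  have i_mono: "strict_mono_on {1..n} i"
    using l(3) by (intro strict_mono_onI) (auto simp: i_def intro!: sorted_wrt_nth_less[OF l(1)])
  define a where "a j = inv_into R c (i j)" for j
  have a: "a j \<in> R" "c (a j) = i j" if "j \<in> {1..n}" for j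
    using imageI[OF that, of i] unfolding i_img
    by (auto simp: a_def intro: inv_into_into f_inv_into_f)
  have "inj_on a {1..n}"
    by (metis a(2) i_mono inj_onI inj_on_def strict_mono_on_imp_inj_on)
  moreover have "R = a ` {1..n}"
  proof
    show "R \<subseteq> a ` {1..n}"
    proof
      fix x assume x: "x \<in> R"
      then obtain j where "j \<in> {1..n}" "c x = i j"
        using i_img by (metis imageE imageI)
      then show "x \<in> a ` {1..n}"
        using a c(1) x by (metis imageI inj_onD)
    qed
  qed (use a in auto)
  moreover have "\<forall>j\<in>{1..n}. a j \<in> A (i j)"
    using a c(3) by force
  ultimately show ?thesis
    unfolding rainbow_set_def using i_mono i_img c(2) by blast
qed

section \<open>Claw-freeness and augmentation of an independent set\<close>

locale claw_free_graph = pair_graph +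
  assumes claw_free: "claw_free G"
begin

lemma arc_sym: "(u, v) \<in> parcs G \<Longrightarrow> (v, u) \<in> parcs G"
  using arcs_symmetric by blast

lemma finite_independent: "independent_set G Z \<Longrightarrow> finite Z"
  by (meson finite_subset independent_set_def pair_finite_verts)

text \<open>Three neighbours of \<open>v\<close> in \<open>Z\<close> are pairwise non-adjacent and
  would induce a claw with centre \<open>v\<close>.\<close>

lemma card_neighbours_in_le_2:
  assumes Z: "independent_set G Z" and v: "v \<in> pverts G"
  shows "card (neighbours_in G Z v) \<le> 2"
proof (rule ccontr)
  assume "\<not> ?thesis"
  then have "3 \<le> card (neighbours_in G Z v)" by simp
  then obtain U where U: "U \<subseteq> neighbours_in G Z v" "card U = 3"
    by (meson obtain_subset_with_card_n)
  then have fU: "finite U" and UZ: "U \<subseteq> Z" and Uv: "\<And>u. u \<in> U \<Longrightarrow> (v, u) \<in> parcs G"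
    by (auto simp: neighbours_in_def card_ge_0_finite)
  have Uvert: "U \<subseteq> pverts G"
    using UZ Z by (auto simp: independent_set_def)
  have vU: "v \<notin> U"
    using Uv no_loops' by blast
  define H where "H = \<lparr>pverts = insert v U, parcs = {v} \<times> U \<union> U \<times> {v}\<rparr>"
  have "complete_bipartite_digraph 1 3 (with_proj H)"
    unfolding complete_bipartite_digraph_pair_def
  proof (intro conjI exI)
    show "finite (pverts H)" using fU by (simp add: H_def)
    show "pverts H = {v} \<union> U" "parcs H = {v} \<times> U \<union> U \<times> {v}" by (auto simp: H_def)
  qed (use vU U in auto)
  moreover have "induced_subgraph (with_proj H) (with_proj G)"
  proof (rule induced_subgraphI)
    have wfH: "wf_digraph (with_proj H)"
      by unfold_locales (auto simp: H_def)
    show "subgraph (with_proj H) (with_proj G)"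
      by (rule subgraphI)
        (use v Uvert Uv arc_sym wfH in \<open>auto simp: H_def compatible_def wf_digraph\<close>)
    show "arcs (with_proj H) = {e \<in> arcs (with_proj G). tail (with_proj G) e \<in> verts (with_proj H)
        \<and> head (with_proj G) e \<in> verts (with_proj H)}"
      using Uv arc_sym UZ Z no_loops' by (auto simp: H_def dest: independent_setD)
  qed
  ultimately show False
    using claw_free unfolding claw_free_def by blast
qed

text \<open>The set \<open>Z\<^sub>0\<close> plays the role of the vertices outside \<open>I\<close> on an augmenting path: a minimal
  violation of Hall's condition forces every neighbour of \<open>Z\<^sub>0\<close> in \<open>I\<close> to be hit twice, and then
  counting edges leaves room for two ends only.\<close>

lemma obtain_augmentation:
  assumes I: "independent_set G I" and Z: "independent_set G Z" and less: "card I < card Z"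
  obtains Z\<^sub>0 where "Z\<^sub>0 \<subseteq> Z" and "has_independent G (I \<union> Z\<^sub>0) (Suc (card I))"
    and "(\<Sum>z\<in>Z\<^sub>0. 2 - card (neighbours_in G I z)) \<le> 2"
proof -
  define N where "N Y = (\<Union>z\<in>Y. neighbours_in G I z)" for Y
  have fI: "finite I" and fZ: "finite Z"
    using I Z finite_independent by auto
  have N_mono: "N X \<subseteq> N Y" if "X \<subseteq> Y" for X Y
    using that by (auto simp: N_def)
  have NI: "N Y \<subseteq> I" and fN: "finite (N Y)" for Y
    using fI by (auto simp: N_def neighbours_in_def intro: finite_subset)
  define P where "P Y \<longleftrightarrow> Y \<subseteq> Z - I \<and> card (N Y) < card Y" for Y
  \<comment> \<open>Independence of \<open>Z\<close> keeps the neighbours of \<open>Z - I\<close>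
    out of \<open>Z\<close>, so \<open>Z - I\<close> itself violates Hall's condition.\<close>
  have "N (Z - I) \<subseteq> I - Z"
    using Z by (auto simp: N_def neighbours_in_def dest: independent_setD)
  then have "card (N (Z - I)) \<le> card (I - Z)"
    using fI by (intro card_mono) auto
  also have "\<dots> < card (Z - I)"
    using less card_less_sym_Diff[OF fI fZ] by blast
  finally have "P (Z - I)" by (simp add: P_def)
  then obtain Y where Y: "P Y" and Y_min: "\<And>X. P X \<Longrightarrow> card Y \<le> card X"
    using ex_has_least_nat[of P "Z - I" card] by blast
  have YZ: "Y \<subseteq> Z - I" and NY: "card (N Y) < card Y"
    using Y by (auto simp: P_def)
  have fY: "finite Y" using YZ fZ by (auto intro: finite_subset)
  have Y_verts: "Y \<subseteq> pverts G"
    using YZ Z by (auto simp: independent_set_def)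
  \<comment> \<open>By minimality \<open>Y - {z}\<close> is no violation, which squeezes the
    cardinalities: deleting \<open>z\<close> loses no neighbour, and \<open>Y\<close> exceeds
    \<open>N Y\<close> by exactly one.\<close>
  have N_remove: "N (Y - {z}) = N Y" and card_N: "Suc (card (N Y)) = card Y" if z: "z \<in> Y" for z
  proof -
    have "\<not> P (Y - {z})"
      using Y_min[of "Y - {z}"] z fY card_Diff1_less[of Y z] by auto
    then have "card Y - 1 \<le> card (N (Y - {z}))"
      using YZ z fY by (auto simp: P_def)
    moreover have "card (N (Y - {z})) \<le> card (N Y)"
      by (intro card_mono fN N_mono) auto
    ultimately have eq: "card (N (Y - {z})) = card (N Y)" "Suc (card (N Y)) = card Y"
      using NY by auto
    show "N (Y - {z}) = N Y"
      by (rule card_subset_eq[OF fN N_mono eq(1)]) auto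
    show "Suc (card (N Y)) = card Y" by (fact eq(2))
  qed
  have hit_twice: "2 \<le> card {z \<in> Y. v \<in> neighbours_in G I z}" if v: "v \<in> N Y" for v
  proof -
    obtain z where z: "z \<in> Y" "v \<in> neighbours_in G I z"
      using v by (auto simp: N_def)
    obtain z' where z': "z' \<in> Y - {z}" "v \<in> neighbours_in G I z'"
      using v N_remove[OF z(1)] by (auto simp: N_def)
    have "card {z, z'} \<le> card {z \<in> Y. v \<in> neighbours_in G I z}"
      by (rule card_mono) (use fY z z' in auto)
    then show ?thesis using z' by auto
  qed
  have deg_le: "card (neighbours_in G I z) \<le> 2" if "z \<in> Y" for z
    using card_neighbours_in_le_2[OF I] that Y_verts by auto
  have "2 * card (N Y) \<le> (\<Sum>v\<in>N Y. card {z \<in> Y. v \<in> neighbours_in G I z})"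
    using sum_bounded_below[of "N Y" "2 :: nat"] hit_twice by (simp add: mult.commute)
  also have "\<dots> = (\<Sum>z\<in>Y. card {v \<in> N Y. v \<in> neighbours_in G I z})"
    by (rule sum_multicount_gen) (auto simp: fN fY)
  also have "\<dots> = (\<Sum>z\<in>Y. card (neighbours_in G I z))"
    by (intro sum.cong arg_cong[of _ _ card]) (auto simp: N_def)
  finally have lower: "2 * card (N Y) \<le> (\<Sum>z\<in>Y. card (neighbours_in G I z))" .
  \<comment> \<open>The bound \<open>deg_le\<close> makes the truncated subtraction exact.\<close>
  have "(\<Sum>z\<in>Y. 2 - card (neighbours_in G I z)) + (\<Sum>z\<in>Y. card (neighbours_in G I z)) = 2 * card Y"
    using deg_le by (simp add: sum.distrib[symmetric])
  moreover have cY: "card Y = Suc (card (N Y))"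
    using NY card_N by fastforce
  ultimately have deficiency: "(\<Sum>z\<in>Y. 2 - card (neighbours_in G I z)) \<le> 2"
    using lower by simp
  \<comment> \<open>Exchanging \<open>N Y\<close> for \<open>Y\<close> removes every conflict with
    \<open>I\<close> and gains one vertex.\<close>
  have "(x, z) \<notin> parcs G \<and> (z, x) \<notin> parcs G" if "x \<in> I - N Y" "z \<in> Y" for x z
    using that arc_sym by (auto simp: N_def neighbours_in_def)
  moreover have "independent_set G Y"
    using YZ by (intro independent_set_subset[OF Z]) auto
  ultimately have "independent_set G (I - N Y \<union> Y)"
    using I by (auto simp: independent_set_def)
  moreover have "card (I - N Y \<union> Y) = Suc (card I)"
  proof -
    have "card (I - N Y \<union> Y) = card (I - N Y) + card Y"
      using YZ fI fY by (intro card_Un_disjoint) auto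
    then show ?thesis
      using cY NI[of Y] card_Diff_subset[OF fN NI, of Y] card_mono[OF fI NI, of Y] by simp
  qed
  ultimately have "has_independent G (I \<union> Y) (Suc (card I))"
    unfolding has_independent_def by (intro exI[of _ "I - N Y \<union> Y"]) auto
  then show ?thesis
    using that[of Y] YZ deficiency by blast
qed

text \<open>\<open>S\<close> is kept apart from \<open>I\<close> for the induction on
  \<open>card T\<close>: vertices already paid for enter \<open>S\<close>, while edges are always
  counted towards the fixed set \<open>I\<close>.\<close>

lemma rainbow_augmentation:
  assumes I: "independent_set G I" and "I \<subseteq> S" and "finite T" and "finite J"
    and "\<And>j. j \<in> J \<Longrightarrow> has_independent G (S \<union> A j \<inter> T) (Suc (card I))"
    and "(\<Sum>x\<in>T. card (neighbours_in G I x)) < 2 * card J"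
  shows "\<exists>W\<subseteq>T. rainbow_from A J W \<and> has_independent G (S \<union> W) (Suc (card I))"
  using assms(2-)
proof (induction "card T" arbitrary: S T J rule: less_induct)
  case less
  let ?deg = "\<lambda>x. card (neighbours_in G I x)"
  let ?k = "Suc (card I)"
  note IS = less.prems(1) and fT = less.prems(2) and fJ = less.prems(3)
    and ind = less.prems(4) and edges = less.prems(5)
  show ?case
  proof (cases "\<exists>x\<in>T. 2 \<le> ?deg x")
    case True
    then obtain x where x: "x \<in> T" "2 \<le> ?deg x" by blast
    have sum_x: "(\<Sum>y\<in>T. ?deg y) = ?deg x + (\<Sum>y\<in>T - {x}. ?deg y)"
      using fT x(1) by (rule sum.remove)
    have smaller: "card (T - {x}) < card T"
      using fT x(1) by (rule card_Diff1_less)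
    show ?thesis
    proof (cases "\<forall>j\<in>J. has_independent G (S \<union> A j \<inter> (T - {x})) ?k")
      case True
      then have "\<exists>W\<subseteq>T - {x}. rainbow_from A J W \<and> has_independent G (S \<union> W) ?k"
        by (intro less.hyps) (use smaller IS fT fJ edges sum_x in auto)
      then show ?thesis by blast
    next
      case False
      then obtain j where j: "j \<in> J" "\<not> has_independent G (S \<union> A j \<inter> (T - {x})) ?k"
        by blast
      have xj: "x \<in> A j"
      proof (rule ccontr)
        assume "x \<notin> A j"
        then have "A j \<inter> (T - {x}) = A j \<inter> T" by auto
        then show False using j ind by simp
      qed
      \<comment> \<open>Giving up \<open>j\<close> lowers the right side by 2, and removing
        \<open>x\<close> lowers the left side by at least 2, so the strict bound survives.\<close>
      have "2 * card (J - {j}) = 2 * card J - 2"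
        using j(1) fJ by simp
      then have "(\<Sum>y\<in>T - {x}. ?deg y) < 2 * card (J - {j})"
        using edges sum_x x(2) by simp
      moreover have "has_independent G (insert x S \<union> A i \<inter> (T - {x})) ?k" if "i \<in> J - {j}" for i
        by (rule has_independent_mono[OF ind[of i]]) (use that in auto)
      ultimately have "\<exists>W\<subseteq>T - {x}. rainbow_from A (J - {j}) W
          \<and> has_independent G (insert x S \<union> W) ?k"
        by (intro less.hyps) (use smaller IS fT fJ in auto)
      then obtain W where W: "W \<subseteq> T - {x}" "rainbow_from A (J - {j}) W"
          "has_independent G (insert x S \<union> W) ?k"
        by blast
      have "rainbow_from A ({j} \<union> (J - {j})) ({x} \<union> W)"
        using W(2) xj by (intro rainbow_from_Un rainbow_from_singleton[of j]) auto
      moreover have "{j} \<union> (J - {j}) = J" using j(1) by auto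
      ultimately show ?thesis
        using W x(1) by (intro exI[of _ "insert x W"]) auto
    qed
  next
    case False
    then have single: "1 \<le> 2 - ?deg x" if "x \<in> T" for x
      using that by force
    \<comment> \<open>The strict edge bound makes \<open>card J\<close> positive.\<close>
    obtain j where j: "j \<in> J"
      using edges by fastforce
    obtain Z where Z: "Z \<subseteq> S \<union> A j \<inter> T" "independent_set G Z" "card Z = ?k"
      using ind[OF j] by (auto simp: has_independent_def)
    obtain Z\<^sub>0 where Z\<^sub>0: "Z\<^sub>0 \<subseteq> Z" "has_independent G (I \<union> Z\<^sub>0) ?k" "(\<Sum>z\<in>Z\<^sub>0. 2 - ?deg z) \<le> 2"
      using obtain_augmentation[OF I Z(2)] Z(3) by (metis lessI)
    have fZ\<^sub>0: "finite Z\<^sub>0"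
      using Z\<^sub>0(1) finite_independent[OF Z(2)] by (rule finite_subset)
    \<comment> \<open>Only the vertices of \<open>Z\<^sub>0\<close> outside \<open>S\<close> need a
      colour; they lie in \<open>A j \<inter> T\<close>.\<close>
    define W where "W = Z\<^sub>0 - S"
    have fW: "finite W" and WT: "W \<subseteq> T" and WA: "W \<subseteq> A j"
      using fZ\<^sub>0 Z\<^sub>0(1) Z(1) by (auto simp: W_def)
    have W_ind: "has_independent G (S \<union> W) ?k"
      by (rule has_independent_mono[OF Z\<^sub>0(2)]) (use IS in \<open>auto simp: W_def\<close>)
    have W_sum: "(\<Sum>z\<in>W. 2 - ?deg z) \<le> 2"
      using sum_mono2[OF fZ\<^sub>0, of W "\<lambda>z. 2 - ?deg z"] Z\<^sub>0(3) by (auto simp: W_def)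
    \<comment> \<open>A vertex of \<open>T\<close> now has at most one neighbour in
      \<open>I\<close>, so it contributes at least 1 to a sum bounded by 2.\<close>
    have "card W \<le> (\<Sum>z\<in>W. 2 - ?deg z)"
      using sum_bounded_below[of W 1 "\<lambda>z. 2 - ?deg z"] single WT by auto
    then have "card W \<le> 2" using W_sum by simp
    then consider "card W = 0" | "card W = 1" | "card W = 2" by linarith
    then consider "W = {}" | x where "W = {x}" | x y where "W = {x, y}" "x \<noteq> y"
      using fW by cases (auto simp: card_1_singleton_iff card_2_iff)
    then show ?thesis
    proof cases
      case 1
      then have "rainbow_from A J W" by (simp add: rainbow_from_empty)
      then show ?thesis using W_ind WT by blast
    next
      case (2 x)
      then have "rainbow_from A J W" using WA j by (auto intro: rainbow_from_singleton)
      then show ?thesis using W_ind WT by blast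
    next
      case (3 x y)
      show ?thesis
      proof (cases "\<exists>i\<in>J - {j}. x \<in> A i \<or> y \<in> A i")
        case True
        then obtain i where "i \<in> J" "i \<noteq> j" "x \<in> A i \<or> y \<in> A i" by blast
        then have "rainbow_from A J W"
          using j 3 WA rainbow_from_pair[of i J j x A y] rainbow_from_pair[of j J i x A y] by auto
        then show ?thesis using W_ind WT by blast
      next
        case False
        \<comment> \<open>Both terms \<open>2 - ?deg z\<close> are at least 1 and they add up to at
          most 2, so each equals 1. The two edges thus found pay for discarding
          \<open>j\<close>.\<close>
        have "?deg x \<ge> 1" "?deg y \<ge> 1"
          using W_sum single[of x] single[of y] WT 3 by auto
        moreover have "(\<Sum>z\<in>T. ?deg z) = (\<Sum>z\<in>T - {x, y}. ?deg z) + (\<Sum>z\<in>{x, y}. ?deg z)"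
          using fT WT 3 by (intro sum.subset_diff) auto
        moreover have "2 * card (J - {j}) = 2 * card J - 2"
          using j fJ by simp
        ultimately have "(\<Sum>z\<in>T - {x, y}. ?deg z) < 2 * card (J - {j})"
          using edges 3(2) by simp
        moreover have "A i \<inter> (T - {x, y}) = A i \<inter> T" if "i \<in> J - {j}" for i
          using that False by auto
        moreover have "card (T - {x, y}) < card T"
          using fT WT 3 by (intro psubset_card_mono) auto
        ultimately have "\<exists>W\<subseteq>T - {x, y}. rainbow_from A (J - {j}) W \<and> has_independent G (S \<union> W) ?k"
          by (intro less.hyps) (use IS fT fJ ind in auto)
        then show ?thesis
          using rainbow_from_mono[of A "J - {j}" _ J] by blast
      qed
    qed
  qed
qed

section \<open>Edge counting and the number of sets required\<close>

lemma card_neighbours_in_le_max_degree: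
  assumes "v \<in> pverts G"
  shows "card (neighbours_in G T v) \<le> max_degree G"
proof -
  have "card (neighbours_in G T v) = card (Pair v ` neighbours_in G T v)"
    by (simp add: card_image inj_on_def)
  also have "\<dots> \<le> card (out_arcs (with_proj G) v)"
    by (rule card_mono) (auto simp: neighbours_in_def out_arcs_def intro: finite_subset)
  also have "\<dots> = vertex_degree G v"
    by (simp add: vertex_degree_def out_degree_def)
  also have "\<dots> \<le> max_degree G"
    using assms by (auto simp: max_degree_def)
  finally show ?thesis .
qed

text \<open>Double counting: each vertex of \<open>I\<close> sees at most
  \<open>max_degree G\<close> of these edges.\<close>

lemma sum_card_neighbours_in_le:
  assumes "independent_set G I" and "finite T"
  shows "(\<Sum>x\<in>T. card (neighbours_in G I x)) \<le> max_degree G * card I"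
proof -
  have "(\<Sum>x\<in>T. card (neighbours_in G I x)) = (\<Sum>v\<in>I. card (neighbours_in G T v))"
    unfolding neighbours_in_def
  proof (rule sum_multicount_gen)
    show "\<forall>v\<in>I. card {x \<in> T. (x, v) \<in> parcs G} = card {x \<in> T. (v, x) \<in> parcs G}"
      by (intro ballI arg_cong[of _ _ card]) (auto intro: arc_sym)
  qed (use assms finite_independent in auto)
  also have "\<dots> \<le> (\<Sum>v\<in>I. max_degree G)"
    using assms(1) by (intro sum_mono card_neighbours_in_le_max_degree) (auto simp: independent_set_def)
  finally show ?thesis by (simp add: mult.commute)
qed

lemma rainbow_independent_extend:
  assumes A: "\<And>k. k \<in> {1..t} \<Longrightarrow> independent_set G (A k) \<and> card (A k) = n"
    and R: "independent_set G R" "rainbow_from A {1..t} R" "card R < n"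
    and t: "(max_degree G + 2) * card R < 2 * t"
  shows "\<exists>R'. independent_set G R' \<and> rainbow_from A {1..t} R' \<and> card R' = Suc (card R)"
proof -
  obtain c where c: "inj_on c R" "c ` R \<subseteq> {1..t}" "\<forall>w\<in>R. w \<in> A (c w)"
    using R(2) by (auto simp: rainbow_from_def)
  have fR: "finite R" using R(1) by (rule finite_independent)
  define J where "J = {1..t} - c ` R"
  have "card J = t - card R"
    using c fR by (simp add: J_def card_Diff_subset card_image)
  then have "max_degree G * card R < 2 * card J"
    using t by (simp add: algebra_simps)
  then have "(\<Sum>x\<in>pverts G. card (neighbours_in G R x)) < 2 * card J"
    using sum_card_neighbours_in_le[OF R(1), of "pverts G"] by simp
  moreover have "has_independent G (R \<union> A j \<inter> pverts G) (Suc (card R))" if "j \<in> J" for j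
  proof -
    have j: "independent_set G (A j)" "card (A j) = n"
      using A that by (auto simp: J_def)
    obtain Z where "Z \<subseteq> A j" "card Z = Suc (card R)"
      using obtain_subset_with_card_n[of "Suc (card R)" "A j"] R(3) j(2) by auto
    moreover from this have "independent_set G Z"
      using j(1) by (blast intro: independent_set_subset)
    ultimately show ?thesis
      unfolding has_independent_def by (intro exI[of _ Z]) (auto simp: independent_set_def)
  qed
  ultimately obtain W where W: "rainbow_from A J W" "has_independent G (R \<union> W) (Suc (card R))"
    using rainbow_augmentation[OF R(1) subset_refl, of "pverts G" J A] by (auto simp: J_def)
  have "rainbow_from A (c ` R \<union> J) (R \<union> W)"
    using c W(1) by (intro rainbow_from_Un) (auto simp: J_def rainbow_from_def)
  moreover have "c ` R \<union> J = {1..t}"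
    using c(2) by (auto simp: J_def)
  ultimately have "rainbow_from A {1..t} (R \<union> W)" by simp
  then show ?thesis
    using W(2) rainbow_from_subset unfolding has_independent_def by blast
qed

text \<open>The empty set is extended \<open>n\<close> times; the last extension starts from size
  \<open>n - 1\<close> and is the most demanding on \<open>t\<close>.\<close>

lemma forces_rainbow_independent_if:
  assumes t: "(max_degree G + 2) * (n - 1) < 2 * t"
  shows "forces_rainbow_independent G n t"
  unfolding forces_rainbow_independent_def
proof (intro allI impI)
  fix A assume A: "\<forall>k\<in>{1..t}. independent_set G (A k) \<and> card (A k) = n"
  have "\<exists>R. independent_set G R \<and> rainbow_from A {1..t} R \<and> card R = r" if "r \<le> n" for r
    using that
  proof (induction r)
    case 0
    show ?case
      by (intro exI[of _ "{}"]) (simp add: independent_set_def rainbow_from_empty)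
  next
    case (Suc r)
    then obtain R where R: "independent_set G R" "rainbow_from A {1..t} R" "card R = r" by auto
    have "(max_degree G + 2) * r \<le> (max_degree G + 2) * (n - 1)"
      using Suc.prems by (intro mult_le_mono) auto
    then show ?case
      using rainbow_independent_extend[of t A n R] A R t Suc.prems by auto
  qed
  then obtain R where "independent_set G R" "rainbow_from A {1..t} R" "card R = n" by blast
  then show "\<exists>R. rainbow_set A t n R \<and> independent_set G R"
    using rainbow_set_of_rainbow_from finite_independent by blast
qed

end

theorem theorem1p9:
  fixes G :: "'a pair_pre_digraph" and \<Delta> n :: nat
  assumes "pair_graph G"
    and "claw_free G"
    and "max_degree G \<le> \<Delta>"
    and "n \<ge> 1"
  shows "forces_rainbow_independent G n (nat \<lfloor>(real \<Delta> / 2 + 1) * (real n - 1)\<rfloor> + 1)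
    \<and> rainbow_number G n \<le> nat \<lfloor>(real \<Delta> / 2 + 1) * (real n - 1)\<rfloor> + 1"
proof -
  interpret pair_graph G by fact
  interpret claw_free_graph G by unfold_locales fact
  define q where "q = (real \<Delta> / 2 + 1) * (real n - 1)"
  define t where "t = nat \<lfloor>q\<rfloor> + 1"
  have "real ((max_degree G + 2) * (n - 1)) \<le> real ((\<Delta> + 2) * (n - 1))"
    using assms(3) by (intro of_nat_mono mult_le_mono) auto
  also have "\<dots> = 2 * q"
    using assms(4) by (simp add: q_def of_nat_diff field_simps)
  also have "q < real t"
  \<comment> \<open>Applying \<open>nat\<close> never lowers the floor, so the added 1 lifts
    \<open>t\<close> above \<open>q\<close>.\<close>
  proof -
    have "real_of_int \<lfloor>q\<rfloor> \<le> real (nat \<lfloor>q\<rfloor>)"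
      by (cases "0 \<le> \<lfloor>q\<rfloor>") auto
    then show ?thesis
      unfolding t_def of_nat_add by linarith
  qed
  finally have "real ((max_degree G + 2) * (n - 1)) < real (2 * t)"
    by simp
  then have "(max_degree G + 2) * (n - 1) < 2 * t"
    by (simp only: of_nat_less_iff)
  then have forces: "forces_rainbow_independent G n t"
    by (rule forces_rainbow_independent_if)
  then have "rainbow_number G n \<le> t"
    unfolding rainbow_number_def by (rule Least_le)
  with forces show ?thesis
    by (simp add: t_def q_def)
qed

end
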